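(* Let $X,Y$ be Banach spaces, $\mathcal{N}\colon D(\mathcal{N})\subset X\to Y$ an operator with an isolated root $u^{*}\in D(\mathcal{N})$, $\mathcal{N}(u^{*})=0$, and $U\subset D(\mathcal{N})$ an open neighborhood containing $u^{*}$. Let $\{u^{(k)}\}_{k\ge 0}$ be generated by the LiL-Q iteration, with increments $\delta u^{(k)}=u^{(k+1)}-u^{(k)}$ and projection residuals $$r^{(k)}:=\mathcal{N}'(u^{(k)})(\delta u^{(k)})+\mathcal{N}(u^{(k)})\in Y .$$ Suppose that: (i) $\mathcal{N}$ is continuously Fréchet differentiable on $U$, i.e. $\mathcal{N}\in C^{1}(U;Y)$; (ii) there exists $\Gamma>0$ such that $\|\mathcal{N}'(u)\|_{\mathcal{L}(X,Y)}\le\Gamma$ for all $u\in U$; (iii) $u^{(k)}\in U$ for all $k\ge 0$; (iv) there are constants $\varepsilon_L,\varepsilon_U$ with $0<\varepsilon_{L}\le\|r^{(k)}\|_{Y}\le\varepsilon_{U}$ for all $k\ge 0$. Then for all $k\ge 0$ $$\varepsilon_{L}-\Gamma\,\|\delta u^{(k)}\|_{X}\;\le\;\|\mathcal{N}(u^{(k)})\|_{Y}\;\le\;\varepsilon_{U}+\Gamma\,\|\delta u^{(k)}\|_{X}.$$ If moreover the sequence $\{u^{(k)}\}$ converges to a limit $\hat u\in U$, so that $\delta u^{(k)}\to 0$, then the limiting nonlinear residual satisfies $\varepsilon_{L}\le\|\mathcal{N}(\hat u)\|_{Y}\le\varepsilon_{U}$.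
   Context: LiL-Q iteration: let $\phi_1,\dots,\phi_P\in X$ be fixed basis functions and $V_P=\mathrm{span}\{\phi_1,\dots,\phi_P\}\subset X$. Starting from $u^{(0)}\in V_P$, given $u^{(k)}$ the next iterate $u^{(k+1)}\in V_P$ is obtained by solving, in the least-squares sense over $V_P$, the quasilinearized (linear) equation $$\mathcal{N}'(u^{(k)})(u^{(k+1)})=\mathcal{N}'(u^{(k)})(u^{(k)})-\mathcal{N}(u^{(k)}),$$ where $\mathcal{N}'(u)$ denotes the Fréchet derivative. Since $u^{(k+1)}$ is restricted to $V_P$, the equation is in general not satisfied exactly, and $r^{(k)}\in Y$, as defined in the claim, is the residual remaining after the least-squares solve. The iteration enters the statement only through the sequence $\{u^{(k)}\}$ and the residuals $r^{(k)}$. *)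

theory Defs
  imports "HOL-Analysis.Analysis"
begin

text \<open>
  Here \<open>A\<close> is a continuous linear operator and \<open>b\<close> a right-hand side; \<open>w\<close> solves \<open>A w = b\<close> over
  the trial space \<open>V\<close> in the least-squares sense. The size of a residual is measured by a
  seminorm \<open>q\<close>, which is a parameter because the norm of a Banach space need not come from an
  inner product: \<open>q = norm\<close>, a weaker \<open>L\<^sup>2\<close> norm, and the root of a finite
  sum of squares of residual values at collocation points are all instances.
\<close>

definition seminorm :: "('b::real_vector \<Rightarrow> real) \<Rightarrow> bool" where
  "seminorm q \<longleftrightarrow>
     (\<forall>x y. q (x + y) \<le> q x + q y) \<and> (\<forall>c x. q (c *\<^sub>R x) = \<bar>c\<bar> * q x)"

definition least_squares_solution ::
    "('b::real_normed_vector \<Rightarrow> real) \<Rightarrow> 'a::real_normed_vector set \<Rightarrow> ('a \<Rightarrow>\<^sub>L 'b) \<Rightarrow> 'b \<Rightarrow> 'a \<Rightarrow> bool"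
  where
  "least_squares_solution q V A b w \<longleftrightarrow>
     w \<in> V \<and> (\<forall>v\<in>V. (q (blinfun_apply A w - b))\<^sup>2 \<le> (q (blinfun_apply A v - b))\<^sup>2)"

definition trial_space :: "(nat \<Rightarrow> 'a::real_vector) \<Rightarrow> nat \<Rightarrow> 'a set" where
  "trial_space \<phi> P = span (\<phi> ` {1..P})"

text \<open>
  The argument \<open>N'\<close> is the derivative map of \<open>N\<close>; that it really is the Frechet derivative is
  a separate condition. Least-squares minimizers need not be unique, so the iteration is a
  property of a sequence.
\<close>

definition lilq_iteration ::
    "('b::real_normed_vector \<Rightarrow> real) \<Rightarrow> (nat \<Rightarrow> 'a::real_normed_vector) \<Rightarrow> nat \<Rightarrow>
     ('a \<Rightarrow> 'b) \<Rightarrow> ('a \<Rightarrow> 'a \<Rightarrow>\<^sub>L 'b) \<Rightarrow> (nat \<Rightarrow> 'a) \<Rightarrow> bool"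
  where
  "lilq_iteration q \<phi> P N N' u \<longleftrightarrow>
     u 0 \<in> trial_space \<phi> P \<and>
     (\<forall>k. least_squares_solution q (trial_space \<phi> P) (N' (u k))
            (blinfun_apply (N' (u k)) (u k) - N (u k)) (u (Suc k)))"

definition increment :: "(nat \<Rightarrow> 'a::real_vector) \<Rightarrow> nat \<Rightarrow> 'a" where
  "increment u k = u (Suc k) - u k"

definition projection_residual ::
    "('a::real_normed_vector \<Rightarrow> 'b::real_normed_vector) \<Rightarrow> ('a \<Rightarrow> 'a \<Rightarrow>\<^sub>L 'b) \<Rightarrow>
     (nat \<Rightarrow> 'a) \<Rightarrow> nat \<Rightarrow> 'b"
  where
  "projection_residual N N' u k = blinfun_apply (N' (u k)) (increment u k) + N (u k)"

text \<open>
  \<open>N\<close> is continuously Frechet differentiable on \<open>U\<close> with derivative \<open>N'\<close>, continuity being with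
  respect to the operator norm. For open \<open>U\<close> this determines \<open>N'\<close> on \<open>U\<close>.
\<close>

definition C1_on ::
    "'a::real_normed_vector set \<Rightarrow> ('a \<Rightarrow> 'b::real_normed_vector) \<Rightarrow> ('a \<Rightarrow> 'a \<Rightarrow>\<^sub>L 'b) \<Rightarrow> bool"
  where
  "C1_on U N N' \<longleftrightarrow>
     (\<forall>x\<in>U. (N has_derivative blinfun_apply (N' x)) (at x)) \<and> continuous_on U N'"

end

theory Submission imports Defs begin

text \<open>The residual and \<open>N (u k)\<close> differ exactly by the derivative
  \<open>N' (u k)\<close> applied to the increment, a vector of norm at most
  \<open>\<Gamma> * norm (increment u k)\<close>. The triangle inequality in both directions turns
  the bounds on the residual into bounds on \<open>norm (N (u k))\<close>. If the iterates converge,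
  the increments vanish, so the residuals and the values \<open>N (u k)\<close> have the same limit;
  continuity of \<open>N\<close> identifies it as \<open>N uhat\<close>, and closed bounds on norms
  survive the limit.\<close>

text \<open>Serves twice: as the estimate at a fixed index, and as the majorant that makes the
  residuals asymptotic to the values of \<open>N\<close>.\<close>

lemma norm_projection_residual_diff:
  assumes "norm (N' (u k)) \<le> \<Gamma>"
  shows "norm (projection_residual N N' u k - N (u k)) \<le> \<Gamma> * norm (increment u k)"
proof -
  have "norm (blinfun_apply (N' (u k)) (increment u k)) \<le> norm (N' (u k)) * norm (increment u k)"
    by (rule norm_blinfun)
  also have "\<dots> \<le> \<Gamma> * norm (increment u k)"
    using assms by (intro mult_right_mono) auto
  finally show ?thesis
    by (simp add: projection_residual_def)
qed

lemma increment_tendsto_zero: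
  fixes u :: "nat \<Rightarrow> 'a::real_normed_vector"
  assumes "u \<longlonglongrightarrow> l"
  shows "increment u \<longlonglongrightarrow> 0"
  using tendsto_diff[OF LIMSEQ_Suc[OF assms] assms] by (simp add: increment_def[abs_def])

text \<open>The derivative is taken in the full filter \<open>at x\<close>, so differentiability
  yields continuity in the whole space and not merely within \<open>U\<close>.\<close>

lemma C1_on_isCont:
  assumes "C1_on U N N'" "x \<in> U"
  shows "isCont N x"
  using assms has_derivative_continuous unfolding C1_on_def by blast

theorem theorem2:
  fixes N :: "'a::banach \<Rightarrow> 'b::banach"
    and N' :: "'a \<Rightarrow> 'a \<Rightarrow>\<^sub>L 'b"
    and D U :: "'a set"
    and ustar :: 'a
    and q :: "'b \<Rightarrow> real"
    and \<phi> :: "nat \<Rightarrow> 'a"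
    and P :: nat
    and u :: "nat \<Rightarrow> 'a"
    and \<Gamma> \<epsilon>\<^sub>L \<epsilon>\<^sub>U :: real
  assumes root: "ustar \<in> D" "N ustar = 0"
    and isolated: "ustar isolated_in {v \<in> D. N v = 0}"
    and nbhd: "open U" "ustar \<in> U" "U \<subseteq> D"
    and seminorm: "seminorm q"
    and iteration: "lilq_iteration q \<phi> P N N' u"
    and C1: "C1_on U N N'"
    and Gamma: "\<Gamma> > 0" "\<And>v. v \<in> U \<Longrightarrow> norm (N' v) \<le> \<Gamma>"
    and iterates: "\<And>k. u k \<in> U"
    and eps_pos: "0 < \<epsilon>\<^sub>L"
    and residual_lower: "\<And>k. \<epsilon>\<^sub>L \<le> norm (projection_residual N N' u k)"
    and residual_upper: "\<And>k. norm (projection_residual N N' u k) \<le> \<epsilon>\<^sub>U"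
  shows "(\<forall>k. \<epsilon>\<^sub>L - \<Gamma> * norm (increment u k) \<le> norm (N (u k)) \<and>
              norm (N (u k)) \<le> \<epsilon>\<^sub>U + \<Gamma> * norm (increment u k)) \<and>
         (\<forall>uhat\<in>U. u \<longlonglongrightarrow> uhat \<longrightarrow>
            increment u \<longlonglongrightarrow> 0 \<and> \<epsilon>\<^sub>L \<le> norm (N uhat) \<and> norm (N uhat) \<le> \<epsilon>\<^sub>U)"
proof (intro conjI allI ballI impI)
  fix k
  have diff: "norm (projection_residual N N' u k - N (u k)) \<le> \<Gamma> * norm (increment u k)"
    by (intro norm_projection_residual_diff Gamma(2) iterates)
  show "\<epsilon>\<^sub>L - \<Gamma> * norm (increment u k) \<le> norm (N (u k))"
    using diff residual_lower[of k] norm_triangle_ineq2[of "projection_residual N N' u k" "N (u k)"]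
    by linarith
  show "norm (N (u k)) \<le> \<epsilon>\<^sub>U + \<Gamma> * norm (increment u k)"
    \<comment> \<open>The upper bound needs the norm of \<open>N (u k)\<close> minus that of the
      residual. The form with an absolute value covers this opposite sign while keeping the
      difference oriented as in \<open>diff\<close>.\<close>
    using diff residual_upper[of k] norm_triangle_ineq3[of "projection_residual N N' u k" "N (u k)"]
    by linarith
next
  fix uhat
  assume uhat: "uhat \<in> U" and lim: "u \<longlonglongrightarrow> uhat"
  show incr: "increment u \<longlonglongrightarrow> 0"
    by (rule increment_tendsto_zero[OF lim])
  have "(\<lambda>k. N (u k)) \<longlonglongrightarrow> N uhat"
    by (rule isCont_tendsto_compose[OF C1_on_isCont[OF C1 uhat] lim])
  \<comment> \<open>The uniform bound \<open>\<Gamma>\<close> on the derivatives makes the vanishing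
    increments force this difference to zero.\<close>
  moreover have "(\<lambda>k. projection_residual N N' u k - N (u k)) \<longlonglongrightarrow> 0"
  proof (rule Lim_null_comparison)
    show "\<forall>\<^sub>F k in sequentially.
        norm (projection_residual N N' u k - N (u k)) \<le> \<Gamma> * norm (increment u k)"
      by (intro always_eventually allI norm_projection_residual_diff Gamma(2) iterates)
    show "(\<lambda>k. \<Gamma> * norm (increment u k)) \<longlonglongrightarrow> 0"
      by (intro tendsto_mult_right_zero tendsto_norm_zero incr)
  qed
  ultimately have "projection_residual N N' u \<longlonglongrightarrow> N uhat"
    using Lim_transform by fastforce
  \<comment> \<open>Passing to the limit in the residual norms, rather than in the estimate for
    \<open>N (u k)\<close>, leaves the constant bounds \<open>\<epsilon>\<^sub>L\<close> and
    \<open>\<epsilon>\<^sub>U\<close> with no correction term.\<close>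
  then have norm_lim: "(\<lambda>k. norm (projection_residual N N' u k)) \<longlonglongrightarrow> norm (N uhat)"
    by (rule tendsto_norm)
  show "\<epsilon>\<^sub>L \<le> norm (N uhat)"
    using residual_lower by (intro LIMSEQ_le_const[OF norm_lim]) auto
  show "norm (N uhat) \<le> \<epsilon>\<^sub>U"
    using residual_upper by (intro LIMSEQ_le_const2[OF norm_lim]) auto
qed

end
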